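(* Let $s\ge 2$ and $t\ge 1$ be integers. If $G$ is the complement of the point-graph of a generalized quadrangle of order $(s,t)$, then the toughness of $G$ equals $st$. Moreover, $S$ is a disconnecting set of vertices of $G$ such that $\frac{|S|}{c(G\setminus S)}=st$ if and only if $S$ is the complement of a maximum independent set of $G$, or $s=2$ and $S$ is the neighborhood of a vertex of $G$.
   Context: All graphs are finite, simple and undirected. A generalized quadrangle is a (finite, nonempty) point-line incidence structure such that any two distinct points are on at most one line and, if $p$ is a point not on a line $L$, then there is a unique point on $L$ that is collinear with $p$. It has order $(s,t)$ if every line contains exactly $s+1$ points and every point is contained in exactly $t+1$ lines. Its point-graph has the points as vertices, two distinct points being adjacent if and only if they are collinear (lie on a common line); in the complement of the point-graph two distinct points are adjacent if and only if they are not collinear. For a connected graph $G$ and a vertex subset $S$, $c(G\setminus S)$ denotes the number of connected components of the graph obtained from $G$ by removing the vertices of $S$; $S$ is called disconnecting if $c(G\setminus S)\ge 2$. The toughness of $G$ is $\min_S \frac{|S|}{c(G\setminus S)}$, the minimum being over all disconnecting vertex sets $S$. The neighborhood of a vertex is the set of vertices adjacent to it. *)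

theory Defs
  imports Complex_Main "Graph_Theory.Graph_Theory"
begin

section \<open>Generalized quadrangles\<close>

record ('p, 'l) incidence_structure =
  points :: "'p set"
  lines :: "'l set"
  incidence :: "('p \<times> 'l) set"

text \<open>Every point lying on some line is collinear with itself.\<close>

definition collinear :: "('p, 'l) incidence_structure \<Rightarrow> 'p \<Rightarrow> 'p \<Rightarrow> bool" where
  "collinear Q p q \<longleftrightarrow>
     (\<exists>L \<in> lines Q. (p, L) \<in> incidence Q \<and> (q, L) \<in> incidence Q)"

text \<open>
  Nonemptiness is required of the point set only; if the structure has an order, the set of
  lines is then nonempty as well, and conversely.
\<close>

locale generalized_quadrangle =
  fixes Q :: "('p, 'l) incidence_structure"
  assumes finite_points: "finite (points Q)"
    and finite_lines: "finite (lines Q)"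
    and nonempty: "points Q \<noteq> {}"
    and incidence_subset: "incidence Q \<subseteq> points Q \<times> lines Q"
    and at_most_one_line:
      "\<lbrakk>p \<in> points Q; q \<in> points Q; p \<noteq> q; L \<in> lines Q; M \<in> lines Q;
        (p, L) \<in> incidence Q; (q, L) \<in> incidence Q;
        (p, M) \<in> incidence Q; (q, M) \<in> incidence Q\<rbrakk> \<Longrightarrow> L = M"
    and unique_collinear:
      "\<lbrakk>p \<in> points Q; L \<in> lines Q; (p, L) \<notin> incidence Q\<rbrakk>
        \<Longrightarrow> \<exists>!q. q \<in> points Q \<and> (q, L) \<in> incidence Q \<and> collinear Q p q"

definition has_order :: "('p, 'l) incidence_structure \<Rightarrow> nat \<Rightarrow> nat \<Rightarrow> bool" where
  "has_order Q s t \<longleftrightarrow>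
     (\<forall>L \<in> lines Q. card {p \<in> points Q. (p, L) \<in> incidence Q} = s + 1) \<and>
     (\<forall>p \<in> points Q. card {L \<in> lines Q. (p, L) \<in> incidence Q} = t + 1)"


section \<open>Point-graph and complement\<close>

text \<open>
  As in \<^theory>\<open>Graph_Theory.Digraph\<close>, simple undirected graphs are symmetric loop-free
  digraphs without parallel arcs, both orientations of an edge being present.
\<close>

definition point_graph :: "('p, 'l) incidence_structure \<Rightarrow> 'p pair_pre_digraph" where
  "point_graph Q =
     \<lparr> pverts = points Q,
       parcs = {(p, q). p \<in> points Q \<and> q \<in> points Q \<and> p \<noteq> q \<and> collinear Q p q} \<rparr>"

definition complement_graph :: "'a pair_pre_digraph \<Rightarrow> 'a pair_pre_digraph" where
  "complement_graph G =
     \<lparr> pverts = pverts G,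
       parcs = {(u, v). u \<in> pverts G \<and> v \<in> pverts G \<and> u \<noteq> v \<and> (u, v) \<notin> parcs G} \<rparr>"

lemma (in generalized_quadrangle) pair_graph_point_graph: "pair_graph (point_graph Q)"
proof
  show "finite (parcs (point_graph Q))"
    by (rule finite_subset[of _ "points Q \<times> points Q"])
      (auto simp: point_graph_def finite_points)
qed (auto simp: point_graph_def symmetric_def sym_def collinear_def finite_points)

lemma pair_graph_complement_graph:
  assumes "pair_graph G"
  shows "pair_graph (complement_graph G)"
proof -
  interpret pair_graph G by fact
  show ?thesis
  proof
    show "finite (parcs (complement_graph G))"
      by (rule finite_subset[of _ "pverts G \<times> pverts G"])
        (auto simp: complement_graph_def pair_finite_verts)
  qed (use pair_sym_arcs in
      \<open>auto simp: complement_graph_def symmetric_def sym_def pair_finite_verts\<close>)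
qed


section \<open>Toughness\<close>

text \<open>
  The strongly connected components of a symmetric digraph are the connected components of the
  underlying undirected graph.
\<close>

definition num_components :: "('a, 'b) pre_digraph \<Rightarrow> nat" where
  "num_components G = card (pre_digraph.sccs_verts G)"

definition remove_verts :: "('a, 'b) pre_digraph \<Rightarrow> 'a set \<Rightarrow> ('a, 'b) pre_digraph" where
  "remove_verts G S = G \<restriction> (verts G - S)"

definition disconnecting :: "('a, 'b) pre_digraph \<Rightarrow> 'a set \<Rightarrow> bool" where
  "disconnecting G S \<longleftrightarrow> S \<subseteq> verts G \<and> num_components (remove_verts G S) \<ge> 2"

text \<open>
  The value is unspecified if there is no disconnecting set, that is, for complete graphs.
  For a disconnected graph it is 0, attained by the empty set.
\<close>

definition toughness :: "('a, 'b) pre_digraph \<Rightarrow> real" where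
  "toughness G =
     Min {real (card S) / real (num_components (remove_verts G S)) | S. disconnecting G S}"


section \<open>Independent sets and neighborhoods\<close>

definition independent_set :: "('a, 'b) pre_digraph \<Rightarrow> 'a set \<Rightarrow> bool" where
  "independent_set G A \<longleftrightarrow> A \<subseteq> verts G \<and> (\<forall>u \<in> A. \<forall>v \<in> A. \<not> u \<rightarrow>\<^bsub>G\<^esub> v)"

definition maximum_independent_set :: "('a, 'b) pre_digraph \<Rightarrow> 'a set \<Rightarrow> bool" where
  "maximum_independent_set G A \<longleftrightarrow>
     independent_set G A \<and> (\<forall>B. independent_set G B \<longrightarrow> card B \<le> card A)"

definition neighborhood :: "('a, 'b) pre_digraph \<Rightarrow> 'a \<Rightarrow> 'a set" where
  "neighborhood G v = {u. v \<rightarrow>\<^bsub>G\<^esub> u}"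

end

theory Submission
  imports Defs
begin

text \<open>
  Points of \<open>G - S\<close> lying in different components are collinear, and a set of pairwise collinear
  points lies on a line. So if \<open>W\<close>, the complement of \<open>S\<close>, is a clique of the point-graph, then
  there are \<open>card W \<le> s + 1\<close> components. Otherwise some component contains two noncollinear points
  \<open>x\<close>, \<open>y\<close>; points of two further components would span with each of \<open>x\<close> and \<open>y\<close> one and the same
  line, so there are exactly two components \<open>A\<close> and \<open>B\<close>, every point of \<open>A\<close> being collinear with
  every point of \<open>B\<close>. Either \<open>B\<close> is a clique as well, and then \<open>W\<close> consists of points collinear with
  some point of \<open>B\<close>; or both \<open>A\<close> and \<open>B\<close> contain noncollinear points, and then each has at most
  \<open>t + 1\<close> points. Counting the points of the quadrangle gives the bound and the cases of equality.
\<close>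

section \<open>Components of symmetric digraphs\<close>

context sym_digraph
begin

text \<open>Symmetry of the arcs makes one-way reachability an equivalence relation, so components
  can be told apart by paths in a single direction.\<close>

lemma scc_of_eq_iff:
  assumes "u \<in> verts G" "v \<in> verts G"
  shows "scc_of u = scc_of v \<longleftrightarrow> u \<rightarrow>\<^sup>* v"
proof
  assume "scc_of u = scc_of v"
  then have "v \<in> scc_of u"
    using in_scc_of_self assms by simp
  then show "u \<rightarrow>\<^sup>* v"
    by (simp add: scc_of_def)
next
  assume "u \<rightarrow>\<^sup>* v"
  moreover from this have "v \<rightarrow>\<^sup>* u"
    by (rule symmetric_reachable')
  ultimately show "scc_of u = scc_of v"
    by (auto simp: scc_of_def intro: reachable_trans)
qed

lemma num_components_conv: "num_components G = card (scc_of ` verts G)"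
  by (simp add: num_components_def sccs_verts_conv_scc_of)

lemma num_components_edgeless:
  assumes "\<And>u v. \<not> u \<rightarrow> v"
  shows "num_components G = card (verts G)"
proof -
  have "u = v" if "u \<rightarrow>\<^sup>* v" for u v
    using that assms by (auto elim: converse_reachable_cases)
  then have "inj_on scc_of (verts G)"
    by (intro inj_onI) (simp add: scc_of_eq_iff)
  then show ?thesis
    by (simp add: num_components_conv card_image)
qed

end

section \<open>Geometry and counting in a generalized quadrangle\<close>

locale gq_order = generalized_quadrangle +
  fixes s t :: nat
  assumes order: "has_order Q s t" and s_ge: "s \<ge> 2" and t_ge: "t \<ge> 1"
begin

abbreviation pts :: "'b \<Rightarrow> 'a set" where
  "pts L \<equiv> {p \<in> points Q. (p, L) \<in> incidence Q}"

abbreviation pencil :: "'a \<Rightarrow> 'b set" where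
  "pencil p \<equiv> {L \<in> lines Q. (p, L) \<in> incidence Q}"

abbreviation perp :: "'a \<Rightarrow> 'a set" where
  "perp p \<equiv> {q \<in> points Q. collinear Q p q}"

lemma card_pts: "L \<in> lines Q \<Longrightarrow> card (pts L) = s + 1"
  using order by (simp add: has_order_def)

lemma card_pencil: "p \<in> points Q \<Longrightarrow> card (pencil p) = t + 1"
  using order by (simp add: has_order_def)

lemma finite_pts [simp]: "finite (pts L)" and finite_perp [simp]: "finite (perp p)"
  and finite_pencil [simp]: "finite (pencil p)"
  using finite_points finite_lines by simp_all

lemma collinear_sym: "collinear Q p q \<Longrightarrow> collinear Q q p"
  by (auto simp: collinear_def)

lemma ex_line:
  assumes "p \<in> points Q"
  obtains L where "L \<in> lines Q" "(p, L) \<in> incidence Q"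
proof -
  have "card (pencil p) \<noteq> 0"
    using card_pencil[OF assms] by simp
  then have "pencil p \<noteq> {}"
    by (metis card.empty)
  then show ?thesis
    using that by blast
qed

lemma collinear_refl: "p \<in> points Q \<Longrightarrow> collinear Q p p"
  using ex_line[of p] unfolding collinear_def by blast

text \<open>A point off \<open>L\<close> is collinear with exactly one point of \<open>L\<close>,
  whereas \<open>a\<close> and \<open>b\<close> are two.\<close>

lemma no_triangle:
  assumes "x \<in> points Q" "a \<in> points Q" "b \<in> points Q" "a \<noteq> b"
    and "collinear Q x a" "collinear Q x b"
    and "L \<in> lines Q" "(a, L) \<in> incidence Q" "(b, L) \<in> incidence Q"
  shows "(x, L) \<in> incidence Q"
  using unique_collinear[of x L] assms by blast

lemma clique_on_line:
  assumes "C \<subseteq> points Q" and clique: "\<And>x y. x \<in> C \<Longrightarrow> y \<in> C \<Longrightarrow> collinear Q x y"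
  obtains L where "L \<in> lines Q" "C \<subseteq> pts L"
proof (cases "\<exists>a \<in> C. \<exists>b \<in> C. a \<noteq> b")
  case True
  then obtain a b where ab: "a \<in> C" "b \<in> C" "a \<noteq> b" by blast
  then obtain L where L: "L \<in> lines Q" "(a, L) \<in> incidence Q" "(b, L) \<in> incidence Q"
    using clique[of a b] by (auto simp: collinear_def)
  have "x \<in> pts L" if "x \<in> C" for x
    using no_triangle[of x a b L] L ab assms that by blast
  then show ?thesis
    using that L by blast
next
  case False
  \<comment> \<open>If \<open>C\<close> is empty, \<open>p\<close> is an arbitrary point; otherwise
    it is the only point of \<open>C\<close>.\<close>
  obtain p where p: "p \<in> points Q" "C \<subseteq> {p}"
    using False nonempty assms(1) by blast
  obtain L where "L \<in> lines Q" "(p, L) \<in> incidence Q"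
    using ex_line[OF p(1)] .
  then show ?thesis
    using that[of L] p by blast
qed

lemma pts_clique: "L \<in> lines Q \<Longrightarrow> x \<in> pts L \<Longrightarrow> y \<in> pts L \<Longrightarrow> collinear Q x y"
  by (auto simp: collinear_def)

text \<open>The t + 1 lines through \<open>p\<close> meet pairwise only in \<open>p\<close>, and
  each contributes s further points.\<close>

lemma card_perp:
  assumes p: "p \<in> points Q"
  shows "card (perp p) = s * (t + 1) + 1"
proof -
  have "perp p = insert p (\<Union>L\<in>pencil p. pts L - {p})" (is "_ = insert p ?U")
    using p collinear_refl by (auto simp: collinear_def)
  then have "card (perp p) = card ?U + 1"
    by (simp only:) (subst card_insert_disjoint, auto)
  moreover have "card (\<Union>L\<in>pencil p. pts L - {p}) = (\<Sum>L\<in>pencil p. card (pts L - {p}))"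
    using at_most_one_line p by (intro card_UN_disjoint) auto
  moreover have "\<dots> = (\<Sum>L\<in>pencil p. s)"
    using card_pts p by (intro sum.cong) auto
  ultimately show ?thesis
    using card_pencil[OF p] by (simp add: mult.commute)
qed

text \<open>Fix a line \<open>L\<close>. Each point off \<open>L\<close> is collinear with exactly
  one point of \<open>L\<close>, so the sets \<open>perp p - pts L\<close> for \<open>p\<close> on
  \<open>L\<close> partition the points off \<open>L\<close>, and each has s(t + 1) + 1 - (s + 1) =
  st elements.\<close>

lemma card_points: "card (points Q) = (s + 1) * (s * t + 1)"
proof -
  obtain p0 where "p0 \<in> points Q"
    using nonempty by blast
  then obtain L where L: "L \<in> lines Q"
    using ex_line by blast
  have "points Q = pts L \<union> (\<Union>p\<in>pts L. perp p - pts L)" (is "_ = _ \<union> ?U")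
  proof (intro equalityI subsetI)
    fix q assume q: "q \<in> points Q"
    show "q \<in> pts L \<union> ?U"
    proof (cases "(q, L) \<in> incidence Q")
      case False
      then obtain p where "p \<in> pts L" "collinear Q q p"
        using unique_collinear[OF q L] by auto
      then show ?thesis
        using q False by (auto dest: collinear_sym)
    qed (use q in simp)
  qed auto
  moreover have "card (pts L \<union> ?U) = card (pts L) + card ?U"
    by (intro card_Un_disjoint) auto
  moreover have "card ?U = (\<Sum>p\<in>pts L. card (perp p - pts L))"
  proof (intro card_UN_disjoint ballI impI)
    fix p q assume "p \<in> pts L" "q \<in> pts L" "p \<noteq> q"
    then have "(x, L) \<in> incidence Q" if "x \<in> perp p" "x \<in> perp q" for x
      using no_triangle[of x p q L] that L by (simp add: collinear_sym)
    then show "(perp p - pts L) \<inter> (perp q - pts L) = {}"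
      by blast
  qed auto
  moreover have "\<dots> = (\<Sum>p\<in>pts L. s * t)"
  proof (rule sum.cong)
    fix p assume p: "p \<in> pts L"
    then have "pts L \<subseteq> perp p"
      using L by (auto simp: collinear_def)
    then show "card (perp p - pts L) = s * t"
      using p card_perp[of p] card_pts[OF L] by (simp add: card_Diff_subset)
  qed simp
  ultimately show ?thesis
    using card_pts[OF L] by simp
qed

text \<open>None of the t + 1 lines through \<open>x\<close> contains \<open>y\<close>, so each
  carries just one point collinear with \<open>y\<close>; every point of the intersection lies on
  one of these lines.\<close>

lemma card_common_perp:
  assumes "x \<in> points Q" "y \<in> points Q" "\<not> collinear Q x y"
  shows "card (perp x \<inter> perp y) \<le> t + 1"
proof -
  have "perp x \<inter> perp y \<subseteq> (\<Union>L\<in>pencil x. pts L \<inter> perp y)"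
    by (auto simp: collinear_def)
  then have "card (perp x \<inter> perp y) \<le> card (\<Union>L\<in>pencil x. pts L \<inter> perp y)"
    by (intro card_mono) auto
  also have "\<dots> \<le> (\<Sum>L\<in>pencil x. card (pts L \<inter> perp y))"
    by (intro card_UN_le) simp
  also have "\<dots> \<le> (\<Sum>L\<in>pencil x. 1)"
  proof (rule sum_mono)
    fix L assume L: "L \<in> pencil x"
    then have "(y, L) \<notin> incidence Q"
      using assms by (auto simp: collinear_def)
    then obtain z where "pts L \<inter> perp y \<subseteq> {z}"
      using unique_collinear[of y L] L assms by blast
    then show "card (pts L \<inter> perp y) \<le> 1"
      using card_mono[of "{z}" "pts L \<inter> perp y"] by simp
  qed
  finally show ?thesis
    using card_pencil[OF assms(1)] by simp
qed

section \<open>The complement graph and its vertex-deleted subgraphs\<close>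

abbreviation "V \<equiv> points Q"

abbreviation graph_G :: "'a pair_pre_digraph" where
  "graph_G \<equiv> complement_graph (point_graph Q)"

abbreviation "G_minus S \<equiv> remove_verts (with_proj graph_G) S"

lemma verts_graph_G: "verts (with_proj graph_G) = V"
  by (simp add: complement_graph_def point_graph_def)

text \<open>Distinctness of \<open>u\<close> and \<open>v\<close> is implied: every point lies on a
  line and is thus collinear with itself.\<close>

lemma adj_graph_G:
  "u \<rightarrow>\<^bsub>with_proj graph_G\<^esub> v \<longleftrightarrow> u \<in> V \<and> v \<in> V \<and> \<not> collinear Q u v"
  using collinear_refl by (auto simp: complement_graph_def point_graph_def)

lemma verts_G_minus: "verts (G_minus S) = V - S"
  by (simp add: remove_verts_def complement_graph_def point_graph_def)

lemma adj_G_minus: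
  "u \<rightarrow>\<^bsub>G_minus S\<^esub> v \<longleftrightarrow> u \<in> V - S \<and> v \<in> V - S \<and> \<not> collinear Q u v"
  using collinear_refl
  by (auto simp: remove_verts_def arcs_ends_conv complement_graph_def point_graph_def image_def)

lemma sym_digraph_G_minus: "sym_digraph (G_minus S)"
proof -
  have "pair_graph graph_G"
    by (intro pair_graph_complement_graph pair_graph_point_graph)
  then interpret pair_graph graph_G .
  show ?thesis
    unfolding remove_verts_def by (intro induced_graph_imp_graph induced_induce) auto
qed

section \<open>Components after the removal of \<open>S\<close>\<close>

lemma num_components_clique:
  assumes "\<And>x y. x \<in> V - S \<Longrightarrow> y \<in> V - S \<Longrightarrow> collinear Q x y"
  shows "num_components (G_minus S) = card (V - S)"
proof -
  have "\<not> u \<rightarrow>\<^bsub>G_minus S\<^esub> v" for u v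
    using assms unfolding adj_G_minus by blast
  then show ?thesis
    using sym_digraph.num_components_edgeless[OF sym_digraph_G_minus] verts_G_minus by metis
qed

text \<open>The vertex \<open>v\<close> is isolated. The other vertices form one component:
  noncollinear ones are adjacent, and collinear ones lie on a common line through \<open>v\<close>
  and have a common neighbor on another line through \<open>v\<close>.\<close>

lemma num_components_perp:
  assumes v: "v \<in> V" and S: "V - S = perp v"
  shows "num_components (G_minus S) = 2"
proof -
  interpret sym_digraph "G_minus S" by (rule sym_digraph_G_minus)
  have vW: "v \<in> V - S"
    using S v collinear_refl by blast
  have "\<not> v \<rightarrow>\<^bsub>G_minus S\<^esub> u" for u
    using S by (auto simp: adj_G_minus)
  then have isolated: "\<not> v \<rightarrow>\<^sup>*\<^bsub>G_minus S\<^esub> u" if "u \<noteq> v" for u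
    using that by (auto elim: converse_reachable_cases)
  have conn: "u \<rightarrow>\<^sup>*\<^bsub>G_minus S\<^esub> w" if u: "u \<in> V - S" "u \<noteq> v" and w: "w \<in> V - S" "w \<noteq> v" for u w
  proof (cases "collinear Q u w")
    case False
    then show ?thesis
      using u w by (intro reachable_adjI) (simp add: adj_G_minus)
  next
    case True
    have uvw: "collinear Q v u" "collinear Q v w"
      using u w S by auto
    then obtain L where L: "L \<in> lines Q" "(v, L) \<in> incidence Q" "(u, L) \<in> incidence Q"
      by (auto simp: collinear_def)
    have wL: "(w, L) \<in> incidence Q"
      using no_triangle[of w v u L] L u w v uvw True by (simp add: collinear_sym)
    \<comment> \<open>This is where t >= 1 enters: a second line \<open>M\<close> passes through
      \<open>v\<close>.\<close>
    have "pencil v - {L} \<noteq> {}"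
    proof
      assume "pencil v - {L} = {}"
      then have "card (pencil v) \<le> card {L}"
        by (intro card_mono) auto
      then show False
        using card_pencil[OF v] t_ge by simp
    qed
    then obtain M where M: "M \<in> lines Q" "(v, M) \<in> incidence Q" "M \<noteq> L"
      by blast
    have "pts M - {v} \<noteq> {}"
    proof
      assume "pts M - {v} = {}"
      then have "card (pts M) \<le> card {v}"
        by (intro card_mono) auto
      then show False
        using card_pts[OF M(1)] s_ge by simp
    qed
    then obtain z where z: "z \<in> V" "(z, M) \<in> incidence Q" "z \<noteq> v"
      by blast
    have "collinear Q v z"
      using M z by (auto simp: collinear_def)
    then have zW: "z \<in> V - S"
      using z S by blast
    \<comment> \<open>If \<open>x\<close> were collinear with \<open>z\<close>, then
      \<open>x\<close> would lie on \<open>M\<close> by \<open>no_triangle\<close>, and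
      \<open>L\<close> and \<open>M\<close> would share both \<open>v\<close> and
      \<open>x\<close>.\<close>
    have far: "\<not> collinear Q x z" if x: "x \<in> V - S" "x \<noteq> v" "(x, L) \<in> incidence Q" for x
    proof
      assume "collinear Q x z"
      moreover have "collinear Q x v"
        using x L by (auto simp: collinear_def)
      ultimately have "(x, M) \<in> incidence Q"
        using no_triangle[of x z v M] x z v M by blast
      then show False
        using at_most_one_line[of x v L M] x v L M by blast
    qed
    have "u \<rightarrow>\<^bsub>G_minus S\<^esub> z" "z \<rightarrow>\<^bsub>G_minus S\<^esub> w"
      using far[of u] far[of w] u w L wL zW by (auto simp: adj_G_minus dest: collinear_sym)
    then show ?thesis
      by (meson reachable_adjI reachable_trans)
  qed
  \<comment> \<open>The component other than that of \<open>v\<close> is nonempty.\<close>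
  have "card (perp v) \<noteq> card {v}"
    using card_perp[OF v] s_ge by simp
  then have "perp v \<noteq> {v}"
    by metis
  then obtain u where u: "u \<in> V - S" "u \<noteq> v"
    using S v vW by blast
  have "scc_of ` (V - S) = {scc_of v, scc_of u}"
  proof (intro equalityI subsetI)
    fix C assume "C \<in> scc_of ` (V - S)"
    then obtain w where w: "w \<in> V - S" "C = scc_of w"
      by blast
    then show "C \<in> {scc_of v, scc_of u}"
      using conn[OF w(1) _ u] u by (cases "w = v") (simp_all add: scc_of_eq_iff verts_G_minus)
  qed (use u vW in blast)
  moreover have "scc_of v \<noteq> scc_of u"
    using isolated[OF u(2)] u vW by (simp add: scc_of_eq_iff verts_G_minus)
  ultimately show ?thesis
    by (simp add: num_components_conv verts_G_minus)
qed

text \<open>Each case fixes the number of components and bounds \<open>card (V - S)\<close> from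
  above, which is all that the later counting needs.\<close>

lemma components_cases:
  assumes c2: "num_components (G_minus S) \<ge> 2"
  obtains
    (clique) L where "L \<in> lines Q" "V - S \<subseteq> pts L" "num_components (G_minus S) = card (V - S)"
  | (perp) v where "v \<in> V" "V - S \<subseteq> perp v" "num_components (G_minus S) = 2"
  | (small) "card (V - S) \<le> 2 * (t + 1)" "num_components (G_minus S) = 2"
proof -
  interpret sym_digraph "G_minus S" by (rule sym_digraph_G_minus)
  define W where "W = V - S"
  have WV: "W \<subseteq> V" and W: "W = verts (G_minus S)"
    by (auto simp: W_def verts_G_minus)
  have coll: "collinear Q u w" if "u \<in> W" "w \<in> W" "scc_of u \<noteq> scc_of w" for u w
  proof (rule ccontr)
    assume "\<not> collinear Q u w"
    then have "u \<rightarrow>\<^sup>*\<^bsub>G_minus S\<^esub> w"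
      using that by (intro reachable_adjI) (simp add: adj_G_minus W_def)
    then show False
      using that by (simp add: scc_of_eq_iff W)
  qed
  show ?thesis
  proof (cases "\<forall>x\<in>W. \<forall>y\<in>W. collinear Q x y")
    case True
    then obtain L where "L \<in> lines Q" "W \<subseteq> pts L"
      using clique_on_line[OF WV] by blast
    then show ?thesis
      using clique num_components_clique[of S] True by (simp add: W_def)
  next
    case False
    then obtain x y where xy: "x \<in> W" "y \<in> W" "\<not> collinear Q x y"
      by blast
    then have xy_scc: "scc_of y = scc_of x"
      using coll by metis
    \<comment> \<open>\<open>A\<close> is the component of \<open>x\<close> and \<open>y\<close>;
      \<open>B\<close> gathers all the others, and turns out to be a single component.\<close>
    define A where "A = {w \<in> W. scc_of w = scc_of x}"
    define B where "B = {w \<in> W. scc_of w \<noteq> scc_of x}"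
    have AB: "W = A \<union> B" "A \<inter> B = {}"
      by (auto simp: A_def B_def)
    have fin: "finite A" "finite B"
      using finite_points WV AB(1) by (auto intro: finite_subset)
    have AB_coll: "collinear Q a b" if "a \<in> A" "b \<in> B" for a b
      using that coll[of a b] by (auto simp: A_def B_def)
    have xyA: "x \<in> A" "y \<in> A"
      using xy xy_scc by (auto simp: A_def)
    have "B \<noteq> {}"
    proof
      assume "B = {}"
      then have "scc_of w = scc_of x" if "w \<in> W" for w
        using that by (auto simp: B_def)
      then have "scc_of ` W = {scc_of x}"
        using xy(1) by blast
      then show False
        using c2 by (simp add: num_components_conv flip: W)
    qed
    then obtain b where b: "b \<in> B" by blast
    have B_scc: "scc_of b' = scc_of b" if b': "b' \<in> B" for b'
    proof (rule ccontr)
      assume neq: "scc_of b' \<noteq> scc_of b"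
      then obtain L where L: "L \<in> lines Q" "(b, L) \<in> incidence Q" "(b', L) \<in> incidence Q"
        using coll[of b b'] b b' by (auto simp: B_def collinear_def)
      \<comment> \<open>Each \<open>a\<close> in \<open>A\<close> is collinear with both
        \<open>b\<close> and \<open>b'\<close>; so \<open>A\<close>, and with it the noncollinear
        pair \<open>x\<close>, \<open>y\<close>, would lie on \<open>L\<close>.\<close>
      have "(a, L) \<in> incidence Q" if "a \<in> A" for a
        using no_triangle[of a b b' L] AB_coll that b b' L neq AB(1) WV by blast
      then show False
        using xy(3) xyA L by (auto simp: collinear_def)
    qed
    have "scc_of w = scc_of x \<or> scc_of w = scc_of b" if "w \<in> W" for w
      using B_scc[of w] that by (auto simp: B_def)
    moreover have "b \<in> W"
      using b AB(1) by blast
    ultimately have "scc_of ` W = {scc_of x, scc_of b}"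
      using xy(1) by blast
    moreover have "scc_of x \<noteq> scc_of b"
      using b by (auto simp: B_def)
    ultimately have two: "num_components (G_minus S) = 2"
      by (simp add: num_components_conv flip: W)
    show ?thesis
    proof (cases "\<forall>u\<in>B. \<forall>w\<in>B. collinear Q u w")
      case True
      then have "W \<subseteq> perp b"
        using AB(1) AB_coll b WV True by (auto intro: collinear_sym)
      then show ?thesis
        using perp[of b] two b AB(1) WV by (auto simp: W_def)
    next
      case False
      then obtain u w where uw: "u \<in> B" "w \<in> B" "\<not> collinear Q u w"
        by blast
      \<comment> \<open>Each side lies in the common perp of a noncollinear pair on the other side,
        which has at most t + 1 points.\<close>
      have "B \<subseteq> perp x \<inter> perp y" "A \<subseteq> perp u \<inter> perp w"
        using AB_coll xyA uw AB(1) WV by (auto intro: collinear_sym)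
      then have "card B \<le> card (perp x \<inter> perp y)" "card A \<le> card (perp u \<inter> perp w)"
        by (auto intro!: card_mono)
      moreover have "card (perp x \<inter> perp y) \<le> t + 1" "card (perp u \<inter> perp w) \<le> t + 1"
        using card_common_perp xy uw AB(1) WV by (meson UnCI subsetD)+
      ultimately have "card W \<le> 2 * (t + 1)"
        using AB fin by (simp add: card_Un_disjoint)
      then show ?thesis
        using small two by (simp add: W_def)
    qed
  qed
qed

section \<open>The lower bound for disconnecting sets and its equality cases\<close>

lemma card_add_card_minus: "S \<subseteq> V \<Longrightarrow> card S + card (V - S) = (s + 1) * (s * t + 1)"
  using card_points card_Diff_subset[of S V] card_mono[OF finite_points, of S]
    finite_subset[OF _ finite_points, of S] by linarith

lemma disconnecting_bound:
  assumes S: "S \<subseteq> V" and c2: "num_components (G_minus S) \<ge> 2"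
  shows "s * t * num_components (G_minus S) \<le> card S" (is "?le")
    and "card S = s * t * num_components (G_minus S) \<Longrightarrow>
      (\<exists>L\<in>lines Q. V - S = pts L) \<or> (s = 2 \<and> (\<exists>v\<in>V. V - S = perp v))" (is "?eq \<Longrightarrow> ?char")
proof -
  have total: "card S + card (V - S) = (s + 1) * (s * t + 1)"
    by (rule card_add_card_minus[OF S])
  \<comment> \<open>Writing s = r + 2 keeps the counts below free of truncated subtraction; r = 0 is
    the exceptional case s = 2.\<close>
  obtain r where r: "s = r + 2"
    using s_ge by (metis add.commute le_Suc_ex)
  have "?le \<and> (?eq \<longrightarrow> ?char)"
    using c2
  proof (cases rule: components_cases)
    case (clique L)
    have le: "card (V - S) \<le> s + 1"
      using card_mono[OF finite_pts clique(2)] card_pts[OF clique(1)] by simp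
    \<comment> \<open>\<open>d\<close> counts the points of \<open>L\<close> missing from
      \<open>V - S\<close>. The excess of \<open>card S\<close> over the bound is (st + 1)d, so
      equality forces d = 0.\<close>
    then obtain d where d: "s + 1 = card (V - S) + d"
      using le_Suc_ex by blast
    have "card S = s * t * card (V - S) + (s * t * d + d)"
      using total unfolding d by (simp add: algebra_simps)
    moreover have "V - S = pts L" if "d = 0"
      using that card_subset_eq[OF finite_pts clique(2)] card_pts[OF clique(1)] d by simp
    ultimately show ?thesis
      using clique by auto
  next
    case (perp v)
    have le: "card (V - S) \<le> s * (t + 1) + 1"
      using card_mono[OF finite_perp perp(2)] card_perp[OF perp(1)] by simp
    \<comment> \<open>Now \<open>d\<close> counts the points missing from \<open>perp v\<close>. The
      excess is str + d, so equality forces both r = 0 and d = 0.\<close>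
    then obtain d where d: "s * (t + 1) + 1 = card (V - S) + d"
      using le_Suc_ex by blast
    have "card S + card (V - S) = s * t * 2 + (s * t * r + d) + card (V - S)"
      using total d by (simp add: r algebra_simps)
    then have "card S = s * t * 2 + (s * t * r + d)"
      by simp
    moreover have "V - S = perp v" if "d = 0"
      using that card_subset_eq[OF finite_perp perp(2)] card_perp[OF perp(1)] d by simp
    ultimately show ?thesis
      using perp t_ge by (auto simp: r)
  next
    case small
    \<comment> \<open>The last summand is positive, so the bound is strict and this case yields no
      equality.\<close>
    have "(s + 1) * (s * t + 1) = s * t * 2 + (2 * (t + 1) + (1 + r + (s * t * r + r * t)))"
      by (simp add: r algebra_simps)
    then have "s * t * 2 < card S"
      using total small(1) by simp
    then show ?thesis
      using small(2) by simp
  qed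
  then show ?le "?eq \<Longrightarrow> ?char"
    by blast+
qed

section \<open>Maximum independent sets and neighborhoods\<close>

lemma independent_set_iff:
  "independent_set (with_proj graph_G) A \<longleftrightarrow> A \<subseteq> V \<and> (\<forall>x\<in>A. \<forall>y\<in>A. collinear Q x y)"
  unfolding independent_set_def adj_graph_G verts_graph_G by blast

text \<open>Independent sets of G are sets of pairwise collinear points, hence contained in lines;
  all lines have the same size s + 1.\<close>

lemma maximum_independent_set_iff:
  "maximum_independent_set (with_proj graph_G) A \<longleftrightarrow> (\<exists>L\<in>lines Q. A = pts L)"
proof -
  have indep_pts: "independent_set (with_proj graph_G) (pts L)" if "L \<in> lines Q" for L
    using that by (auto simp: independent_set_iff collinear_def)
  have on_line: "\<exists>L\<in>lines Q. B \<subseteq> pts L" if "independent_set (with_proj graph_G) B" for B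
    using that clique_on_line[of B] unfolding independent_set_iff by metis
  have bound: "card B \<le> s + 1" if B: "independent_set (with_proj graph_G) B" for B
  proof -
    obtain L where L: "L \<in> lines Q" "B \<subseteq> pts L"
      using on_line[OF B] by blast
    then show ?thesis
      using card_mono[OF finite_pts L(2)] card_pts[OF L(1)] by simp
  qed
  show ?thesis
  proof
    assume A: "maximum_independent_set (with_proj graph_G) A"
    then obtain L where L: "L \<in> lines Q" "A \<subseteq> pts L"
      using on_line unfolding maximum_independent_set_def by blast
    then have "card (pts L) \<le> card A"
      using A indep_pts unfolding maximum_independent_set_def by blast
    then have "A = pts L"
      using L(2) card_seteq[OF finite_pts] by blast
    then show "\<exists>L\<in>lines Q. A = pts L"
      using L(1) by blast
  next
    assume "\<exists>L\<in>lines Q. A = pts L"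
    then obtain L where L: "L \<in> lines Q" "A = pts L"
      by blast
    then show "maximum_independent_set (with_proj graph_G) A"
      using indep_pts[OF L(1)] bound card_pts[OF L(1)]
      unfolding maximum_independent_set_def by simp
  qed
qed

lemma neighborhood_eq: "v \<in> V \<Longrightarrow> neighborhood (with_proj graph_G) v = V - perp v"
  unfolding neighborhood_def adj_graph_G by blast

text \<open>What remains is s + 1 isolated vertices, so the ratio is st for every s.\<close>

lemma line_complement:
  assumes L: "L \<in> lines Q"
  shows "num_components (G_minus (V - pts L)) = s + 1" "card (V - pts L) = s * t * (s + 1)"
proof -
  have eq: "V - (V - pts L) = pts L"
    by blast
  show "num_components (G_minus (V - pts L)) = s + 1"
    using num_components_clique[of "V - pts L"] pts_clique[OF L] card_pts[OF L]
    unfolding eq by simp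
  show "card (V - pts L) = s * t * (s + 1)"
    using card_add_card_minus[of "V - pts L"] card_pts[OF L] unfolding eq by simp
qed

text \<open>The ratio is st * s / 2, which equals st exactly when s = 2.\<close>

lemma neighborhood_set:
  assumes v: "v \<in> V"
  shows "num_components (G_minus (V - perp v)) = 2" "card (V - perp v) = s * t * s"
proof -
  have eq: "V - (V - perp v) = perp v"
    by blast
  show "num_components (G_minus (V - perp v)) = 2"
    using num_components_perp[OF v eq] .
  show "card (V - perp v) = s * t * s"
    using card_add_card_minus[of "V - perp v"] card_perp[OF v] unfolding eq
    by (simp add: algebra_simps)
qed

section \<open>The toughness and the sets attaining it\<close>

lemma disconnecting_iff:
  "disconnecting (with_proj graph_G) S \<longleftrightarrow> S \<subseteq> V \<and> num_components (G_minus S) \<ge> 2"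
  unfolding disconnecting_def verts_graph_G by simp

lemma ratio_eq_iff:
  assumes "disconnecting (with_proj graph_G) S"
  shows "real (card S) / real (num_components (G_minus S)) = real (s * t) \<longleftrightarrow>
    card S = s * t * num_components (G_minus S)"
proof -
  have "real (num_components (G_minus S)) \<noteq> 0"
    using assms by (simp add: disconnecting_iff)
  then show ?thesis
    by (simp add: divide_eq_eq flip: of_nat_mult)
qed

text \<open>Left to right is the equality part of \<open>disconnecting_bound\<close>; the converse
  comes from the explicit counts in \<open>line_complement\<close> and
  \<open>neighborhood_set\<close>.\<close>

lemma toughness_attained_iff:
  "disconnecting (with_proj graph_G) S \<and>
     real (card S) / real (num_components (G_minus S)) = real (s * t) \<longleftrightarrow>
   (\<exists>A. maximum_independent_set (with_proj graph_G) A \<and> S = V - A) \<or>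
   (s = 2 \<and> (\<exists>v\<in>V. S = neighborhood (with_proj graph_G) v))" (is "?lhs \<longleftrightarrow> ?rhs")
proof
  assume l: ?lhs
  then have S: "S \<subseteq> V" "num_components (G_minus S) \<ge> 2"
    "card S = s * t * num_components (G_minus S)"
    using ratio_eq_iff disconnecting_iff by auto
  have S_eq: "S = V - C" if "V - S = C" for C
    using that S(1) by blast
  consider L where "L \<in> lines Q" "V - S = pts L" | v where "s = 2" "v \<in> V" "V - S = perp v"
    using disconnecting_bound(2)[OF S] by blast
  then show ?rhs
  proof cases
    case 1
    then have "maximum_independent_set (with_proj graph_G) (pts L)"
      using maximum_independent_set_iff by blast
    then show ?thesis
      using S_eq[OF 1(2)] by blast
  next
    case 2
    then have "S = neighborhood (with_proj graph_G) v"
      using S_eq[OF 2(3)] by (simp add: neighborhood_eq)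
    then show ?thesis
      using 2 by blast
  qed
next
  assume ?rhs
  then consider L where "L \<in> lines Q" "S = V - pts L" | v where "s = 2" "v \<in> V" "S = V - perp v"
  proof (elim disjE exE conjE bexE)
    fix A assume "maximum_independent_set (with_proj graph_G) A" "S = V - A"
    moreover from this obtain L where "L \<in> lines Q" "A = pts L"
      using maximum_independent_set_iff by blast
    ultimately show thesis
      using that(1)[of L] by simp
  next
    fix v assume "s = 2" "v \<in> V" "S = neighborhood (with_proj graph_G) v"
    then show thesis
      using that(2)[of v] by (simp add: neighborhood_eq)
  qed
  then have "disconnecting (with_proj graph_G) S \<and> card S = s * t * num_components (G_minus S)"
  proof cases
    case 1
    then show ?thesis
      using line_complement[OF 1(1)] s_ge unfolding 1(2) disconnecting_iff by simp
  next
    case 2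
    then show ?thesis
      using neighborhood_set[OF 2(2)] 2(1) unfolding 2(3) disconnecting_iff by simp
  qed
  then show ?lhs
    using ratio_eq_iff by blast
qed

lemma toughness_graph_G: "toughness (with_proj graph_G) = real (s * t)"
  unfolding toughness_def
proof (rule Min_eqI)
  let ?R = "{real (card S) / real (num_components (G_minus S)) |S.
    disconnecting (with_proj graph_G) S}"
  \<comment> \<open>\<open>Min\<close> requires a finite set; the ratios are indexed by subsets of
    the finite set \<open>V\<close>.\<close>
  have "?R \<subseteq> (\<lambda>S. real (card S) / real (num_components (G_minus S))) ` Pow V"
    by (auto simp: disconnecting_iff)
  then show "finite ?R"
    by (rule finite_subset) (simp add: finite_points)
  show "real (s * t) \<le> r" if "r \<in> ?R" for r
  proof -
    obtain S where S: "disconnecting (with_proj graph_G) S"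
      and r: "r = real (card S) / real (num_components (G_minus S))"
      using \<open>r \<in> ?R\<close> by blast
    have "real (s * t) * real (num_components (G_minus S)) \<le> real (card S)"
      using disconnecting_bound(1)[of S] S unfolding disconnecting_iff
      by (simp flip: of_nat_mult)
    then show ?thesis
      using S unfolding r disconnecting_iff by (simp add: le_divide_eq)
  qed
  \<comment> \<open>The minimum is attained at the complement of any line, and a line exists because
    there is a point.\<close>
  obtain p where "p \<in> V"
    using nonempty by blast
  then obtain L where "L \<in> lines Q"
    using ex_line by blast
  then have "maximum_independent_set (with_proj graph_G) (pts L)"
    using maximum_independent_set_iff by blast
  then show "real (s * t) \<in> ?R"
    using toughness_attained_iff[of "V - pts L"] by force
qed

end

theorem theorem4p4:
  fixes Q :: "('p, 'l) incidence_structure"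
    and G :: "'p pair_pre_digraph"
    and s t :: nat
  assumes "s \<ge> 2" and "t \<ge> 1"
    and "generalized_quadrangle Q" and "has_order Q s t"
    and "G = complement_graph (point_graph Q)"
  shows "toughness G = real (s * t) \<and>
    (\<forall>S. disconnecting G S \<and>
           real (card S) / real (num_components (remove_verts G S)) = real (s * t)
       \<longleftrightarrow>
         (\<exists>A. maximum_independent_set G A \<and> S = verts G - A) \<or>
         (s = 2 \<and> (\<exists>v \<in> verts G. S = neighborhood G v)))"
proof -
  interpret gq_order Q s t
    using assms by (simp add: gq_order_def gq_order_axioms_def)
  show ?thesis
    unfolding assms(5) verts_graph_G using toughness_graph_G toughness_attained_iff by blast
qed

end
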